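(* Let $f:\mathbb{R}^n\to\mathbb{R}$ be continuously differentiable and bounded below on the level set $L(x_0)=\{x\in\mathbb{R}^n : f(x)\le f(x_0)\}$. Let $\{x_k\}$ be an infinite sequence generated by the nonmonotone trust-region algorithm NMTR described in the context, started at $x_0$, with either choice of the nonmonotone term $T_k$. Suppose that there is $M>0$ with $\|B_k\|\le M$ for all $k$, and that there is $c>0$ such that the trial steps satisfy $\|d_k\|\le c\|g_k\|$ for all $k$. Suppose also that $\{x_k\}$ converges to a point $x^*$, that (with $B_k$ invertible) the trial step first computed at $x_k$ is $d_k=-B_k^{-1}g_k$ with $\|d_k\|=\|-B_k^{-1}g_k\|\le\delta_k$, that the Hessian $H(x)=\nabla^2f(x)$ exists and is continuous in a neighborhood $N(x^*,\varepsilon)$ of $x^*$, and that $$\lim_{k\to\infty}\frac{\|[B_k-H(x^* )]d_k\|}{\|d_k\|}=0.$$ Then: (i) there exists a constant $k_1$ such that for all $k\ge k_1$ we have $x_{k+1}=x_k+d_k$ (with $d_k=-B_k^{-1}g_k$); (ii) the sequence $\{x_k\}$ converges to $x^*$ superlinearly.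
   Context: Notation: $f_k=f(x_k)$, $g_k=\nabla f(x_k)$, $\|\cdot\|$ is a fixed norm on $\mathbb{R}^n$ (and the induced matrix norm), $B_k\in\mathbb{R}^{n\times n}$ is a symmetric matrix (approximation of the Hessian at $x_k$; the update rule is arbitrary), and $q_k(d)=f_k+g_k^Td+\frac12 d^TB_kd$. Superlinear convergence means $\|x_{k+1}-x^*\|=o(\|x_k-x^*\|)$ as $k\to\infty$. Nonmonotone terms: Fix an integer $N\ge 1$ and weights $\eta_i\in[0,1)$, $i\ge 0$. Put $m(k)=\min\{k,N\}$ and $f_{l(k)}=\max_{0\le j\le m(k)} f_{k-j}$. Define $\overline{T}_0=f_0$; for $1\le k<N$, $\overline{T}_k=(1-\eta_{k-1})f_k+\eta_{k-1}\overline{T}_{k-1}$; and for $k\ge N$, $$\overline{T}_k=(1-\eta_{k-1})f_k+\eta_{k-1}(1-\eta_{k-2})f_{k-1}+\cdots+\eta_{k-1}\cdots\eta_{k-N+1}(1-\eta_{k-N})f_{k-N+1}+\eta_{k-1}\cdots\eta_{k-N}f_{k-N}.$$ The term $T_k$ is one of the following two choices (the same choice for all $k$). First choice: $T_0=f_0$, $T_k=f_k+\eta_{k-1}(\overline{T}_k-f_k)$ if $1\le k<N$, and $T_k=\max\{\overline{T}_k,f_k\}$ if $k\ge N$. Second choice: $T_k=f_{l(k)}$ if $k<N$, and $T_k=\max\{\overline{T}_k,f_k\}$ if $k\ge N$. Algorithm NMTR: Parameters $0<\mu_1\le\mu_2<1$ and $0<\rho_1<1\le\rho_2$. Start from $x_0$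 with $\delta_0=\|g_0\|$. At iterate $x_k$ with radius $\delta_k$, compute a trial step $d_k$ as a (possibly approximate) solution of: minimize $q_k(d)$ subject to $\|d\|\le\delta_k$; in particular $\|d_k\|\le\delta_k$. Compute $$\widehat r_k=\frac{T_k-f(x_k+d_k)}{q_k(0)-q_k(d_k)}.$$ Inner cycle: while $\widehat r_k<\mu_1$, replace $\delta_k$ by $\rho_1\delta_k$, recompute the trial step $d_k$ for the new radius, and recompute $\widehat r_k$. When $\widehat r_k\ge\mu_1$, set $x_{k+1}=x_k+d_k$ (successful iteration). If $\widehat r_k\ge\mu_2$ the iteration is very successful and $\delta_{k+1}=\rho_2\delta_k$; otherwise $\delta_{k+1}=\delta_k$ (here $\delta_k$ is the value at the end of the inner cycle). Then choose $B_{k+1}$ and increase $k$ by one. The stopping test is disregarded, so that an infinite sequence is generated, and $g_k\ne0$ for all $k$. Standing assumption (sufficient reduction): there is a constant $\beta\in(0,1)$ such that every computed trial step satisfies $q_k(0)-q_k(d_k)\ge\beta\|g_k\|\min\{\delta_k,\|g_k\|/\|B_k\|\}$, where $\delta_k$ is the radius used for that trial step (and $\|g_k\|/\|B_k\|=+\infty$ if $B_k=0$). *)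

theory Defs
  imports "HOL-Analysis.Analysis" "HOL-Library.Landau_Symbols"
begin

(* The fixed norm on R^n is arbitrary, so it cannot be the type-class norm of real ^ 'n,
   which is Euclidean. *)
definition is_norm :: "('a::real_vector \<Rightarrow> real) \<Rightarrow> bool" where
  "is_norm \<nu> \<longleftrightarrow>
     (\<forall>x. 0 \<le> \<nu> x) \<and> (\<forall>x. \<nu> x = 0 \<longleftrightarrow> x = 0) \<and>
     (\<forall>a x. \<nu> (a *\<^sub>R x) = \<bar>a\<bar> * \<nu> x) \<and> (\<forall>x y. \<nu> (x + y) \<le> \<nu> x + \<nu> y)"

(* Same convention as onorm: the point x = 0 contributes 0 / 0 = 0, which is harmless. *)
definition induced_norm :: "(real ^ 'n \<Rightarrow> real) \<Rightarrow> real ^ 'n ^ 'n \<Rightarrow> real" where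
  "induced_norm \<nu> A = (SUP x. \<nu> (A *v x) / \<nu> x)"

definition quad_model ::
  "(real ^ 'n \<Rightarrow> real) \<Rightarrow> (real ^ 'n \<Rightarrow> real ^ 'n) \<Rightarrow> real ^ 'n ^ 'n \<Rightarrow> real ^ 'n \<Rightarrow> real ^ 'n \<Rightarrow> real"
where
  "quad_model f g B x d = f x + g x \<bullet> d + (1 / 2) * (d \<bullet> (B *v d))"

(* In the nonmonotone terms F k stands for the function value at the k-th iterate. *)

primrec Tbar_init :: "(nat \<Rightarrow> real) \<Rightarrow> (nat \<Rightarrow> real) \<Rightarrow> nat \<Rightarrow> real" where
  "Tbar_init \<eta> F 0 = F 0"
| "Tbar_init \<eta> F (Suc k) = (1 - \<eta> k) * F (Suc k) + \<eta> k * Tbar_init \<eta> F k"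

(* For k >= N the summand j is
   eta_(k-1) ... eta_(k-j) (1 - eta_(k-j-1)) F_(k-j),  j = 0, ..., N-1. *)
definition Tbar :: "nat \<Rightarrow> (nat \<Rightarrow> real) \<Rightarrow> (nat \<Rightarrow> real) \<Rightarrow> nat \<Rightarrow> real" where
  "Tbar N \<eta> F k =
     (if k < N then Tbar_init \<eta> F k
      else (\<Sum>j<N. (\<Prod>i=1..j. \<eta> (k - i)) * (1 - \<eta> (k - j - 1)) * F (k - j))
           + (\<Prod>i=1..N. \<eta> (k - i)) * F (k - N))"

definition f_max :: "nat \<Rightarrow> (nat \<Rightarrow> real) \<Rightarrow> nat \<Rightarrow> real" where
  "f_max N F k = Max ((\<lambda>j. F (k - j)) ` {0..min k N})"

definition nm_term1 :: "nat \<Rightarrow> (nat \<Rightarrow> real) \<Rightarrow> (nat \<Rightarrow> real) \<Rightarrow> nat \<Rightarrow> real" where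
  "nm_term1 N \<eta> F k =
     (if k = 0 then F 0
      else if k < N then F k + \<eta> (k - 1) * (Tbar N \<eta> F k - F k)
      else max (Tbar N \<eta> F k) (F k))"

definition nm_term2 :: "nat \<Rightarrow> (nat \<Rightarrow> real) \<Rightarrow> (nat \<Rightarrow> real) \<Rightarrow> nat \<Rightarrow> real" where
  "nm_term2 N \<eta> F k =
     (if k < N then f_max N F k else max (Tbar N \<eta> F k) (F k))"

definition rhat ::
  "(real ^ 'n \<Rightarrow> real) \<Rightarrow> (real ^ 'n \<Rightarrow> real ^ 'n) \<Rightarrow> real ^ 'n ^ 'n \<Rightarrow> real \<Rightarrow> real ^ 'n \<Rightarrow> real ^ 'n \<Rightarrow> real"
where
  "rhat f g B T x d = (T - f (x + d)) / (quad_model f g B x 0 - quad_model f g B x d)"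

(* A run that never stops. At iteration k the inner cycle reduces the radius p k times, so it
   computes the trial steps d k 0, ..., d k (p k), of which only the last one is accepted.
   delta k is the radius on entry to iteration k; the step d k i is computed for the radius
   rho1 ^ i * delta k. Values d k i with i > p k are irrelevant. T k is the nonmonotone term. *)
definition nmtr_run ::
  "(real ^ 'n \<Rightarrow> real) \<Rightarrow> (real ^ 'n \<Rightarrow> real) \<Rightarrow> (real ^ 'n \<Rightarrow> real ^ 'n) \<Rightarrow>
   real \<Rightarrow> real \<Rightarrow> real \<Rightarrow> real \<Rightarrow> (nat \<Rightarrow> real) \<Rightarrow>
   (nat \<Rightarrow> real ^ 'n ^ 'n) \<Rightarrow> (nat \<Rightarrow> real ^ 'n) \<Rightarrow> (nat \<Rightarrow> real) \<Rightarrow>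
   (nat \<Rightarrow> nat) \<Rightarrow> (nat \<Rightarrow> nat \<Rightarrow> real ^ 'n) \<Rightarrow> bool"
where
  "nmtr_run \<nu> f g \<mu>\<^sub>1 \<mu>\<^sub>2 \<rho>\<^sub>1 \<rho>\<^sub>2 T B x \<delta> p d \<longleftrightarrow>
     \<delta> 0 = \<nu> (g (x 0)) \<and>
     (\<forall>k. g (x k) \<noteq> 0 \<and> transpose (B k) = B k \<and>
       (\<forall>i\<le>p k. \<nu> (d k i) \<le> \<rho>\<^sub>1 ^ i * \<delta> k) \<and>
       (\<forall>i<p k. rhat f g (B k) (T k) (x k) (d k i) < \<mu>\<^sub>1) \<and>
       rhat f g (B k) (T k) (x k) (d k (p k)) \<ge> \<mu>\<^sub>1 \<and>
       x (Suc k) = x k + d k (p k) \<and>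
       \<delta> (Suc k) = (if rhat f g (B k) (T k) (x k) (d k (p k)) \<ge> \<mu>\<^sub>2
                    then \<rho>\<^sub>2 * (\<rho>\<^sub>1 ^ p k * \<delta> k) else \<rho>\<^sub>1 ^ p k * \<delta> k))"

(* The conditional implements the convention \<nu> g / 0 = +infinity. *)
definition sufficient_reduction ::
  "(real ^ 'n \<Rightarrow> real) \<Rightarrow> (real ^ 'n \<Rightarrow> real) \<Rightarrow> (real ^ 'n \<Rightarrow> real ^ 'n) \<Rightarrow> real \<Rightarrow>
   real ^ 'n ^ 'n \<Rightarrow> real ^ 'n \<Rightarrow> real \<Rightarrow> real ^ 'n \<Rightarrow> bool"
where
  "sufficient_reduction \<nu> f g \<beta> B x r d \<longleftrightarrow>
     quad_model f g B x 0 - quad_model f g B x d \<ge>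
       \<beta> * \<nu> (g x) * (if B = 0 then r else min r (\<nu> (g x) / induced_norm \<nu> B))"

end

theory Submission
  imports Defs
begin

text \<open>
  Near the limit \<open>z\<close> of the iterates the gradient is strictly linearized by the Hessian at \<open>z\<close>:
  \<open>g (y + h) - g y - H z h = o(\<parallel>h\<parallel>)\<close> uniformly for \<open>y\<close> close to \<open>z\<close>. Integrating along a segment, the
  error of the quadratic model at \<open>y\<close> is at most \<open>o(\<parallel>h\<parallel>\<^sup>2) + \<parallel>h\<parallel> \<parallel>(B - H z) h\<parallel> / 2\<close>
  (lemma \<open>model_error_uniform\<close>). Everything else is a comparison with this estimate.

  The limit is stationary (\<open>limit_is_stationary\<close>). The function values converge, and so do the
  nonmonotone terms, which are maxima and convex combinations of finitely many recent values. An
  accepted step decreases the function, relative to the nonmonotone term, by a fixed fraction of the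
  predicted reduction; hence the predicted reductions tend to zero. If the gradient stayed away from
  zero, the final radii would tend to zero. The Newton step is admissible at the initial radius and
  is bounded below by a multiple of the gradient, so the initial radii stay away from zero, and the
  inner cycle must reject arbitrarily short steps. For a short step the predicted reduction is of
  first order in the radius and the model error of second order, so such a step is accepted, which
  is a contradiction.

  Consequently the gradients tend to zero, and since \<open>\<parallel>s\<parallel> \<le> c \<parallel>g\<parallel>\<close> so do the Newton steps
  \<open>s = - B\<^sup>-\<^sup>1 g\<close>. Their predicted reduction is at least a multiple of \<open>\<parallel>g\<parallel>\<^sup>2\<close>, hence of \<open>\<parallel>s\<parallel>\<^sup>2\<close>, while
  by the Dennis-More condition the model error is \<open>o(\<parallel>s\<parallel>\<^sup>2)\<close>. So they are eventually accepted.

  Once \<open>x (k + 1) = x k + s k\<close>, the linearization and \<open>B s = - g\<close> give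
  \<open>g (x (k + 1)) = (H z - B) s + o(\<parallel>s\<parallel>) = o(\<parallel>s\<parallel>)\<close>. The bound \<open>\<parallel>s\<parallel> \<le> c \<parallel>g\<parallel>\<close> at the next iterate turns
  this into \<open>\<parallel>s (k + 1)\<parallel> = o(\<parallel>s k\<parallel>)\<close>. Steps that shrink superlinearly force the errors to do the same
  (\<open>superlinear_of_steps\<close>).
\<close>

section \<open>Norms on Euclidean space and induced matrix norms\<close>

lemma is_norm_nonneg: "is_norm \<nu> \<Longrightarrow> 0 \<le> \<nu> x"
  and is_norm_eq_0: "is_norm \<nu> \<Longrightarrow> \<nu> x = 0 \<longleftrightarrow> x = 0"
  and is_norm_scaleR: "is_norm \<nu> \<Longrightarrow> \<nu> (a *\<^sub>R x) = \<bar>a\<bar> * \<nu> x"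
  and is_norm_triangle: "is_norm \<nu> \<Longrightarrow> \<nu> (x + y) \<le> \<nu> x + \<nu> y"
  by (simp_all add: is_norm_def)

lemma is_norm_zero: "is_norm \<nu> \<Longrightarrow> \<nu> 0 = 0"
  by (simp add: is_norm_eq_0)

lemma is_norm_pos: "is_norm \<nu> \<Longrightarrow> 0 < \<nu> x \<longleftrightarrow> x \<noteq> 0"
  using is_norm_nonneg[of \<nu> x] is_norm_eq_0[of \<nu> x] by auto

lemma is_norm_minus: "is_norm \<nu> \<Longrightarrow> \<nu> (- x) = \<nu> x"
  using is_norm_scaleR[of \<nu> "-1" x] by simp

lemma is_norm_sum:
  assumes "is_norm \<nu>"
  shows "\<nu> (\<Sum>i\<in>I. h i) \<le> (\<Sum>i\<in>I. \<nu> (h i))"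
proof (induction I rule: infinite_finite_induct)
  case (insert i I)
  then show ?case
    using is_norm_triangle[OF assms, of "h i" "\<Sum>i\<in>I. h i"] by simp
qed (simp_all add: is_norm_zero[OF assms])

lemma is_norm_upper_bound:
  fixes \<nu> :: "'a::euclidean_space \<Rightarrow> real"
  assumes \<nu>: "is_norm \<nu>"
  obtains b where "0 < b" "\<And>x. \<nu> x \<le> b * norm x"
proof -
  define b where "b = (\<Sum>i\<in>Basis. \<nu> (i::'a))"
  have upper: "\<nu> x \<le> b * norm x" for x
  proof -
    have "\<nu> x = \<nu> (\<Sum>i\<in>Basis. (x \<bullet> i) *\<^sub>R i)"
      by (simp add: euclidean_representation)
    also have "\<dots> \<le> (\<Sum>i\<in>Basis. \<bar>x \<bullet> i\<bar> * \<nu> i)"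
      using is_norm_sum[OF \<nu>, of "\<lambda>i. (x \<bullet> i) *\<^sub>R i" Basis]
      by (simp add: is_norm_scaleR[OF \<nu>])
    also have "\<dots> \<le> (\<Sum>i\<in>Basis. norm x * \<nu> i)"
      by (intro sum_mono mult_right_mono is_norm_nonneg[OF \<nu>] Basis_le_norm)
    finally show ?thesis
      by (simp add: b_def sum_distrib_left mult.commute)
  qed
  have "0 < b"
    unfolding b_def by (intro sum_pos) (auto simp: is_norm_pos[OF \<nu>])
  with upper that show ?thesis
    by blast
qed

text \<open>
  The upper bound on differences makes the norm Lipschitz; continuity then yields a positive minimum
  on the Euclidean unit sphere, which is the lower constant of the norm equivalence below.
\<close>

lemma is_norm_continuous:
  fixes \<nu> :: "'a::euclidean_space \<Rightarrow> real"
  assumes \<nu>: "is_norm \<nu>"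
  shows "continuous_on S \<nu>"
proof -
  obtain b where "0 < b" and upper: "\<And>x. \<nu> x \<le> b * norm x"
    using is_norm_upper_bound[OF \<nu>] by blast
  have "\<bar>\<nu> x - \<nu> y\<bar> \<le> b * dist x y" for x y
    using is_norm_triangle[OF \<nu>, of "x - y" y] is_norm_triangle[OF \<nu>, of "y - x" x]
      upper[of "x - y"] upper[of "y - x"]
    by (simp add: dist_norm norm_minus_commute abs_le_iff)
  then have "b-lipschitz_on S \<nu>"
    using \<open>0 < b\<close> by (intro lipschitz_onI) (auto simp: dist_real_def)
  then show ?thesis
    by (rule lipschitz_on_continuous_on)
qed

lemma norm_equivalence:
  fixes \<nu> :: "'a::euclidean_space \<Rightarrow> real"
  assumes \<nu>: "is_norm \<nu>"
  obtains a b where "0 < a" "0 < b" "\<And>x. a * norm x \<le> \<nu> x" "\<And>x. \<nu> x \<le> b * norm x"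
proof -
  obtain b where "0 < b" and upper: "\<And>x. \<nu> x \<le> b * norm x"
    using is_norm_upper_bound[OF \<nu>] by blast
  have "sphere (0::'a) 1 \<noteq> {}"
    by simp
  then obtain u where u: "u \<in> sphere 0 1" "\<And>y. y \<in> sphere 0 1 \<Longrightarrow> \<nu> u \<le> \<nu> y"
    using continuous_attains_inf[of "sphere 0 1" \<nu>] is_norm_continuous[OF \<nu>] by auto
  have lower: "\<nu> u * norm x \<le> \<nu> x" for x
  proof (cases "x = 0")
    case False
    then have "\<nu> u \<le> \<nu> ((1 / norm x) *\<^sub>R x)"
      by (intro u(2)) simp
    with False show ?thesis
      by (simp add: is_norm_scaleR[OF \<nu>] field_simps)
  qed (simp add: is_norm_nonneg[OF \<nu>])
  have "0 < \<nu> u"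
    using u(1) by (auto simp: is_norm_pos[OF \<nu>])
  then show ?thesis
    using that \<open>0 < b\<close> lower upper by blast
qed

text \<open>
  The algorithm measures with an arbitrary norm, calculus with the Euclidean one. Since the two are
  of the same order, the asymptotic comparisons can be moved from one to the other.
\<close>

lemma is_norm_bigtheta:
  fixes \<nu> :: "'a::euclidean_space \<Rightarrow> real"
  assumes "is_norm \<nu>"
  shows "(\<lambda>k. \<nu> (u k)) \<in> \<Theta>[F](\<lambda>k. norm (u k))"
proof -
  obtain a b where "0 < a" "0 < b" "\<And>x. a * norm x \<le> \<nu> x" "\<And>x. \<nu> x \<le> b * norm x"
    using norm_equivalence[OF assms] by blast
  then show ?thesis
    by (intro bigthetaI'[of a b]) (auto simp: is_norm_nonneg[OF assms])
qed

lemma is_norm_smallo_iff: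
  fixes \<nu> :: "'a::euclidean_space \<Rightarrow> real"
  assumes "is_norm \<nu>"
  shows "(\<lambda>k. \<nu> (u k)) \<in> o[F](\<lambda>k. \<nu> (v k)) \<longleftrightarrow> (\<lambda>k. norm (u k)) \<in> o[F](\<lambda>k. norm (v k))"
  using landau_o.small.in_cong_bigtheta[OF is_norm_bigtheta[OF assms, of u F]]
    landau_o.small.cong_bigtheta[OF is_norm_bigtheta[OF assms, of v F]] by simp

text \<open>
  The induced norm is a supremum of reals, which says something only if the quotients are bounded;
  norm equivalence reduces this to the Euclidean operator norm.
\<close>

lemma induced_norm_le:
  assumes \<nu>: "is_norm \<nu>"
  shows "\<nu> (A *v x) \<le> induced_norm \<nu> A * \<nu> x"
proof (cases "x = 0")
  case False
  obtain a b where ab: "0 < a" "0 < b" "\<And>x. a * norm x \<le> \<nu> x" "\<And>x. \<nu> x \<le> b * norm x"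
    using norm_equivalence[OF \<nu>] by blast
  have "\<nu> (A *v y) / \<nu> y \<le> b * onorm ((*v) A) / a" for y
  proof (cases "y = 0")
    case False
    have "\<nu> (A *v y) \<le> b * norm (A *v y)"
      by (rule ab)
    also have "\<dots> \<le> b * (onorm ((*v) A) * norm y)"
      using ab(2) by (intro mult_left_mono onorm matrix_vector_mul_bounded_linear) auto
    also have "\<dots> \<le> b * onorm ((*v) A) / a * \<nu> y"
      using mult_left_mono[OF ab(3)[of y], of "b * onorm ((*v) A) / a"] ab
        onorm_pos_le[OF matrix_vector_mul_bounded_linear[of A]]
      by (simp add: field_simps)
    finally show ?thesis
      using False by (simp add: pos_divide_le_eq is_norm_pos[OF \<nu>])
  qed (use ab onorm_pos_le[OF matrix_vector_mul_bounded_linear[of A]] in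
      \<open>simp add: is_norm_eq_0[OF \<nu>]\<close>)
  then have "bdd_above (range (\<lambda>y. \<nu> (A *v y) / \<nu> y))"
    by (intro bdd_aboveI) auto
  then have "\<nu> (A *v x) / \<nu> x \<le> induced_norm \<nu> A"
    unfolding induced_norm_def by (rule cSUP_upper[rotated]) simp
  then show ?thesis
    using False by (simp add: pos_divide_le_eq is_norm_pos[OF \<nu>])
qed (simp add: is_norm_zero[OF \<nu>])

lemma induced_norm_pos:
  assumes \<nu>: "is_norm \<nu>" and "A \<noteq> 0"
  shows "0 < induced_norm \<nu> A"
proof -
  obtain y where "A *v y \<noteq> 0"
    using \<open>A \<noteq> 0\<close> matrix_eq[of A 0] by auto
  then have "0 < \<nu> (A *v y)" "0 < \<nu> y"
    using is_norm_pos[OF \<nu>, of "A *v y"] is_norm_pos[OF \<nu>, of y] by auto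
  then have "0 < induced_norm \<nu> A * \<nu> y"
    using induced_norm_le[OF \<nu>, of A y] by linarith
  then show ?thesis
    using \<open>0 < \<nu> y\<close> by (simp add: zero_less_mult_iff)
qed

lemma matrix_inv_vector_cancel:
  fixes A :: "real ^ 'n ^ 'n"
  assumes "invertible A"
  shows "A *v (matrix_inv A *v v) = v"
proof -
  have "A ** matrix_inv A = mat 1"
    using someI_ex[OF assms[unfolded invertible_def]] by (simp add: matrix_inv_def)
  then show ?thesis
    by (simp add: matrix_vector_mul_assoc)
qed

section \<open>Uniform error of the quadratic model\<close>

text \<open>
  Strict differentiability at a point where the derivative is continuous: by the mean value
  inequality the error is controlled by the variation of \<open>H\<close> on a small ball, so the base
  point \<open>y\<close> may move while the linear map \<open>H z\<close> stays fixed.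
\<close>

lemma gradient_linearization:
  fixes g :: "real ^ 'n \<Rightarrow> real ^ 'm"
  assumes U: "open U" "z \<in> U"
    and deriv: "\<And>y. y \<in> U \<Longrightarrow> (g has_derivative (\<lambda>h. H y *v h)) (at y)"
    and cont: "continuous_on U H" and "0 < e"
  obtains r where "0 < r"
    "\<And>y h. dist y z < r \<Longrightarrow> norm h < r \<Longrightarrow> norm (g (y + h) - g y - H z *v h) \<le> e * norm h"
proof -
  \<comment> \<open>Entries of size at most \<open>e / C\<close> keep the operator norm of a matrix at most \<open>e\<close>.\<close>
  define C where "C = real CARD('m) * real CARD('n)"
  have "0 < C"
    by (simp add: C_def)
  have "isCont H z"
    using U cont by (simp add: continuous_on_eq_continuous_at)
  then obtain s where s: "0 < s" "\<And>y. dist y z < s \<Longrightarrow> dist (H y) (H z) < e / C"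
    using \<open>0 < e\<close> \<open>0 < C\<close> unfolding continuous_at_eps_delta
    by (metis divide_pos_pos)
  obtain t where t: "0 < t" "ball z t \<subseteq> U"
    using U openE by blast
  \<comment> \<open>Halved, because \<open>y + h\<close> is only within \<open>2 * r\<close> of \<open>z\<close>.\<close>
  define r where "r = min s t / 2"
  show ?thesis
  proof
    show "0 < r"
      using s t by (simp add: r_def)
    fix y h :: "real ^ 'n"
    assume yh: "dist y z < r" "norm h < r"
    define S where "S = ball z (2 * r)"
    have "S \<subseteq> U"
      using t by (auto simp: S_def r_def)
    have "norm (g (y + h) - g y - H z *v h) \<le> norm ((y + h) - y) * e"
    proof -
      have "norm (g (y + h) - g y - (\<lambda>u v. H u *v v) z ((y + h) - y)) \<le> norm ((y + h) - y) * e"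
      proof (rule differentiable_bound_linearization[where S = S])
        fix u :: real
        assume u: "u \<in> {0..1}"
        have "dist z (y + u *\<^sub>R h) \<le> dist z y + norm (u *\<^sub>R h)"
          using dist_triangle[of z "y + u *\<^sub>R h" y] by (simp add: dist_norm)
        also have "norm (u *\<^sub>R h) \<le> norm h"
          using u mult_right_mono[of u 1 "norm h"] by simp
        finally show "y + u *\<^sub>R (y + h - y) \<in> S"
          using yh by (simp add: S_def dist_commute)
      next
        fix u assume "u \<in> S"
        then show "(g has_derivative (\<lambda>v. H u *v v)) (at u within S)"
          using deriv \<open>S \<subseteq> U\<close> by (blast intro: has_derivative_at_withinI)
        have "\<bar>(H u - H z) $ i $ j\<bar> \<le> e / C" for i j
        proof -
          have "\<bar>(H u - H z) $ i $ j\<bar> \<le> norm ((H u - H z) $ i)"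
            by (rule component_le_norm_cart)
          also have "\<dots> \<le> norm (H u - H z)"
            by (rule Finite_Cartesian_Product.norm_nth_le)
          also have "\<dots> < e / C"
            using s(2)[of u] \<open>u \<in> S\<close> by (simp add: S_def r_def dist_norm norm_minus_commute)
          finally show ?thesis
            by simp
        qed
        then have "onorm ((*v) (H u - H z)) \<le> C * (e / C)"
          unfolding C_def by (rule onorm_le_matrix_component)
        moreover have "(\<lambda>v. H u *v v) - (\<lambda>v. H z *v v) = (*v) (H u - H z)"
          by (simp add: fun_eq_iff matrix_vector_mult_diff_rdistrib)
        ultimately show "onorm ((\<lambda>v. H u *v v) - (\<lambda>v. H z *v v)) \<le> e"
          using \<open>0 < C\<close> by simp
      next
        show "z \<in> S"
          using \<open>0 < r\<close> by (simp add: S_def)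
      qed
      then show ?thesis by simp
    qed
    then show "norm (g (y + h) - g y - H z *v h) \<le> e * norm h"
      by (simp add: mult.commute)
  qed
qed

text \<open>
  Along the segment from \<open>y\<close> to \<open>y + h\<close> the remainder has derivative
  \<open>h \<bullet> (g (y + t h) - g y - A (t h))\<close>, which the linearization of the gradient bounds. Hence a second
  order expansion of \<open>f\<close> follows from the mean value theorem for first derivatives.
\<close>

lemma second_order_expansion:
  fixes f :: "'a::real_inner \<Rightarrow> real"
  assumes grad: "\<And>y. GDERIV f y :> g y" and A: "linear A"
    and lin: "\<And>t. 0 \<le> t \<Longrightarrow> t \<le> 1 \<Longrightarrow> norm (g (y + t *\<^sub>R h) - g y - A (t *\<^sub>R h)) \<le> e * norm (t *\<^sub>R h)"
  shows "\<bar>f (y + h) - f y - g y \<bullet> h - (1 / 2) * (h \<bullet> A h)\<bar> \<le> e * (norm h)\<^sup>2"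
proof -
  define \<phi> where "\<phi> t = f (y + t *\<^sub>R h) - t * (g y \<bullet> h) - t\<^sup>2 / 2 * (h \<bullet> A h)" for t :: real
  have d: "(\<phi> has_derivative (\<lambda>s. s * (h \<bullet> (g (y + t *\<^sub>R h) - g y - A (t *\<^sub>R h))))) (at t within {0..1})" for t
  proof -
    have "(f has_derivative (\<lambda>v. v \<bullet> g (y + t *\<^sub>R h))) (at (y + t *\<^sub>R h))"
      using grad by (simp add: gderiv_def)
    from has_derivative_compose[of "\<lambda>t. y + t *\<^sub>R h" "\<lambda>s. s *\<^sub>R h" t "{0..1}", OF _ this]
      has_derivative_add[OF has_derivative_const[of y] has_derivative_scaleR_left[OF has_derivative_ident, of h]]
    have "((\<lambda>t. f (y + t *\<^sub>R h)) has_derivative (\<lambda>s. (s *\<^sub>R h) \<bullet> g (y + t *\<^sub>R h))) (at t within {0..1})"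
      by simp
    then show ?thesis
      unfolding \<phi>_def
      by (auto intro!: derivative_eq_intros simp: fun_eq_iff linear_cmul[OF A] algebra_simps inner_commute)
  qed
  obtain t where t: "t \<in> {0..1}"
    and eq: "\<phi> 1 - \<phi> 0 = (1 - 0) * (h \<bullet> (g (y + t *\<^sub>R h) - g y - A (t *\<^sub>R h)))"
    using mvt_very_simple[of 0 1 \<phi>, OF _ d] by auto
  have "\<bar>\<phi> 1 - \<phi> 0\<bar> \<le> norm h * norm (g (y + t *\<^sub>R h) - g y - A (t *\<^sub>R h))"
    unfolding eq by (simp add: Cauchy_Schwarz_ineq2)
  also have "\<dots> \<le> norm h * (e * norm (t *\<^sub>R h))"
    using lin t by (intro mult_left_mono) auto
  also have "\<dots> \<le> e * (norm h)\<^sup>2"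
  proof (cases "h = 0")
    case False
    have "0 \<le> e * norm h"
      using lin[of 1] order_trans[OF norm_ge_zero] by fastforce
    then have "0 \<le> e"
      using False by (simp add: zero_le_mult_iff)
    then show ?thesis
      using t mult_right_mono[of t 1 "e * (norm h)\<^sup>2"] by (simp add: power2_eq_square algebra_simps)
  qed simp
  finally show ?thesis
    by (simp add: \<phi>_def)
qed

text \<open>
  The matrix \<open>B\<close> is quantified after the radius, so that one radius serves all the models of a run.
  With \<open>B\<close> bounded the right-hand side is of order \<open>(norm h)\<^sup>2\<close>; under the Dennis-More condition it
  is \<open>o((norm h)\<^sup>2)\<close> along the Newton steps.
\<close>

lemma model_error_uniform:
  fixes f :: "real ^ 'n \<Rightarrow> real"
  assumes grad: "\<And>y. GDERIV f y :> g y"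
    and U: "open U" "z \<in> U"
    and deriv: "\<And>y. y \<in> U \<Longrightarrow> (g has_derivative (\<lambda>h. H y *v h)) (at y)"
    and cont: "continuous_on U H" and "0 < e"
  obtains r where "0 < r"
    "\<And>B y h. dist y z < r \<Longrightarrow> norm h < r \<Longrightarrow>
       \<bar>f (y + h) - quad_model f g B y h\<bar>
         \<le> e * (norm h)\<^sup>2 + 1 / 2 * norm h * norm ((B - H z) *v h)"
proof -
  obtain r where r: "0 < r"
    "\<And>y h. dist y z < r \<Longrightarrow> norm h < r \<Longrightarrow> norm (g (y + h) - g y - H z *v h) \<le> e * norm h"
    using gradient_linearization[OF U deriv cont \<open>0 < e\<close>] by blast
  show ?thesis
  proof
    show "0 < r" by (rule r)
    fix B :: "real ^ 'n ^ 'n" and y h :: "real ^ 'n"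
    assume yh: "dist y z < r" "norm h < r"
    have short: "norm (t *\<^sub>R h) < r" if "0 \<le> t" "t \<le> 1" for t :: real
      using that yh(2) mult_right_mono[of t 1 "norm h"] by simp
    then have "\<bar>f (y + h) - f y - g y \<bullet> h - (1 / 2) * (h \<bullet> (H z *v h))\<bar> \<le> e * (norm h)\<^sup>2"
      by (intro second_order_expansion[OF grad] r(2) yh(1) short matrix_vector_mul_linear)
    moreover have "\<bar>1 / 2 * (h \<bullet> ((B - H z) *v h))\<bar> \<le> 1 / 2 * norm h * norm ((B - H z) *v h)"
      by (simp add: abs_mult Cauchy_Schwarz_ineq2)
    ultimately show "\<bar>f (y + h) - quad_model f g B y h\<bar>
         \<le> e * (norm h)\<^sup>2 + 1 / 2 * norm h * norm ((B - H z) *v h)"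
      by (simp add: quad_model_def matrix_vector_mult_diff_rdistrib inner_diff_right)
  qed
qed

section \<open>Nonmonotone terms\<close>

text \<open>
  The weights are differences of the partial products \<open>P\<close> and the last product, so they are
  nonnegative and telescope to one: the term is a convex combination of the last \<open>N + 1\<close> values.
\<close>

lemma Tbar_le:
  assumes \<eta>: "\<And>i. 0 \<le> \<eta> i \<and> \<eta> i \<le> 1" and "N \<le> k" and F: "\<And>j. j \<le> N \<Longrightarrow> F (k - j) \<le> U"
  shows "Tbar N \<eta> F k \<le> U"
proof -
  define P where "P n = (\<Prod>i=1..n. \<eta> (k - i))" for n
  have P: "0 \<le> P n" "P (Suc n) = P n * \<eta> (k - n - 1)" for n
    using \<eta> by (auto simp: P_def intro!: prod_nonneg)
  have "(\<Sum>j<n. P j * (1 - \<eta> (k - j - 1)) * F (k - j)) + P n * U \<le> U" if "n \<le> N" for n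
    using that
  proof (induction n)
    case (Suc n)
    have "P n * (1 - \<eta> (k - n - 1)) * F (k - n) \<le> P n * (1 - \<eta> (k - n - 1)) * U"
      using \<eta> F[of n] P Suc.prems by (intro mult_left_mono mult_nonneg_nonneg) auto
    then show ?case
      using Suc by (simp add: P(2) algebra_simps)
  qed (simp add: P_def)
  from this[of N] have "(\<Sum>j<N. P j * (1 - \<eta> (k - j - 1)) * F (k - j)) + P N * U \<le> U"
    by simp
  moreover have "P N * F (k - N) \<le> P N * U"
    using P F by (intro mult_left_mono) auto
  ultimately show ?thesis
    using \<open>N \<le> k\<close> by (simp add: Tbar_def P_def)
qed

text \<open>
  From iteration \<open>N\<close> on both choices coincide and use only the last \<open>N + 1\<close> values, which are all
  close to \<open>l\<close> eventually.
\<close>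

lemma nm_term_eventually:
  assumes T: "T = nm_term1 N \<eta> F \<or> T = nm_term2 N \<eta> F" and "1 \<le> N"
    and \<eta>: "\<And>i. 0 \<le> \<eta> i \<and> \<eta> i < 1" and F: "F \<longlonglongrightarrow> l"
  shows "eventually (\<lambda>k. F k \<le> T k) sequentially" and "T \<longlonglongrightarrow> l"
proof -
  have T_eq: "T k = max (Tbar N \<eta> F k) (F k)" if "N \<le> k" for k
    using T that \<open>1 \<le> N\<close> by (auto simp: nm_term1_def nm_term2_def)
  then show lower: "eventually (\<lambda>k. F k \<le> T k) sequentially"
    by (auto intro: eventually_sequentiallyI[of N])
  have upper: "eventually (\<lambda>k. T k \<le> l + e) sequentially" if "0 < e" for e
  proof -
    have "eventually (\<lambda>k. F k < l + e) sequentially"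
      using order_tendstoD(2)[OF F] that by simp
    then obtain K where K: "\<And>k. K \<le> k \<Longrightarrow> F k < l + e"
      by (auto simp: eventually_sequentially)
    have "T k \<le> l + e" if "K + N \<le> k" for k
    proof -
      have "Tbar N \<eta> F k \<le> l + e"
        using \<eta> that by (intro Tbar_le) (auto intro!: less_imp_le[OF K] intro: less_imp_le)
      then show ?thesis
        using T_eq[of k] K[of k] that by simp
    qed
    then show ?thesis
      by (rule eventually_sequentiallyI)
  qed
  show "T \<longlonglongrightarrow> l"
  proof (rule order_tendstoI)
    fix a assume "a < l"
    show "eventually (\<lambda>k. a < T k) sequentially"
      using order_tendstoD(1)[OF F \<open>a < l\<close>] lower by eventually_elim simp
  next
    fix a assume "l < a"
    then show "eventually (\<lambda>k. T k < a) sequentially"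
      using upper[of "(a - l) / 2"] by (auto elim!: eventually_mono simp: field_simps)
  qed
qed

section \<open>Acceptance of trial steps\<close>

text \<open>
  Because the nonmonotone term is at least \<open>f x\<close>, a step passes the test as soon as the monotone ratio
  does, that is, as soon as the model error is a small enough fraction of the predicted reduction.
\<close>

lemma rhat_ge:
  assumes "f x \<le> T" and pos: "0 < quad_model f g B x 0 - quad_model f g B x d"
    and err: "f (x + d) - quad_model f g B x d
      \<le> (1 - \<mu>) * (quad_model f g B x 0 - quad_model f g B x d)"
  shows "\<mu> \<le> rhat f g B T x d"
proof -
  have "quad_model f g B x 0 = f x"
    by (simp add: quad_model_def)
  then show ?thesis
    using assms by (simp add: rhat_def pos_le_divide_eq algebra_simps)
qed

text \<open>
  The sufficient reduction with the moving norm of \<open>B\<close> replaced by its uniform bound. For a nonzero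
  matrix the quotient in the definition is a genuine one.
\<close>

lemma sufficient_reduction_bound:
  assumes \<nu>: "is_norm \<nu>" and red: "sufficient_reduction \<nu> f g \<beta> B x r d"
    and "0 < \<beta>" "B \<noteq> 0" and M: "induced_norm \<nu> B \<le> M"
  shows "\<beta> * \<nu> (g x) * min r (\<nu> (g x) / M) \<le> quad_model f g B x 0 - quad_model f g B x d"
proof -
  have "\<nu> (g x) / M \<le> \<nu> (g x) / induced_norm \<nu> B"
    using M induced_norm_pos[OF \<nu> \<open>B \<noteq> 0\<close>] is_norm_nonneg[OF \<nu>]
    by (intro divide_left_mono) auto
  then have "\<beta> * \<nu> (g x) * min r (\<nu> (g x) / M)
      \<le> \<beta> * \<nu> (g x) * min r (\<nu> (g x) / induced_norm \<nu> B)"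
    using \<open>0 < \<beta>\<close> is_norm_nonneg[OF \<nu>] by (intro mult_left_mono) auto
  also have "\<dots> \<le> quad_model f g B x 0 - quad_model f g B x d"
    using red \<open>B \<noteq> 0\<close> by (simp add: sufficient_reduction_def)
  finally show ?thesis .
qed

section \<open>Stationarity of the limit\<close>

text \<open>
  Otherwise the last rejected step of a late inner cycle would be so short that the linear lower
  bound on the predicted reduction dominates the quadratic model error, and the step would have been
  accepted. The hypothesis on the initial radius guarantees that there is a rejected step: a very
  small final radius can only be the outcome of the inner cycle.
\<close>

lemma limit_is_stationary:
  fixes \<nu> :: "real ^ 'n \<Rightarrow> real" and x :: "nat \<Rightarrow> real ^ 'n"
  assumes \<nu>: "is_norm \<nu>"
    and run: "nmtr_run \<nu> f g \<mu>\<^sub>1 \<mu>\<^sub>2 \<rho>\<^sub>1 \<rho>\<^sub>2 T B x \<delta> p d"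
    and params: "0 < \<mu>\<^sub>1" "\<mu>\<^sub>1 < 1" "0 < \<rho>\<^sub>1" "\<rho>\<^sub>1 < 1" "0 < \<beta>" "0 < M"
    and reduction: "\<And>k i. i \<le> p k \<Longrightarrow>
      \<beta> * \<nu> (g (x k)) * min (\<rho>\<^sub>1 ^ i * \<delta> k) (\<nu> (g (x k)) / M)
        \<le> quad_model f g (B k) (x k) 0 - quad_model f g (B k) (x k) (d k i)"
    and radius: "\<And>k. \<nu> (g (x k)) / M \<le> \<delta> k"
    and conv: "x \<longlonglongrightarrow> z" and cont: "isCont g z"
    and f_conv: "(\<lambda>k. f (x k)) \<longlonglongrightarrow> l" and T_conv: "T \<longlonglongrightarrow> l"
    and T_ge: "eventually (\<lambda>k. f (x k) \<le> T k) sequentially"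
    and r: "0 < r" and model: "\<And>k h. dist (x k) z < r \<Longrightarrow> norm h < r \<Longrightarrow>
      \<bar>f (x k + h) - quad_model f g (B k) (x k) h\<bar> \<le> K * (norm h)\<^sup>2"
  shows "g z = 0"
proof (rule ccontr)
  assume "g z \<noteq> 0"
  obtain a b where ab: "0 < a" "0 < b" "\<And>v. a * norm v \<le> \<nu> v" "\<And>v. \<nu> v \<le> b * norm v"
    using norm_equivalence[OF \<nu>] by blast
  define red where
    "red k i = quad_model f g (B k) (x k) 0 - quad_model f g (B k) (x k) (d k i)" for k i
  define \<gamma> where "\<gamma> = a * norm (g z) / 2"
  have "0 < \<gamma>"
    using \<open>g z \<noteq> 0\<close> ab by (simp add: \<gamma>_def)
  have "(\<lambda>k. norm (g (x k))) \<longlonglongrightarrow> norm (g z)"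
    using isCont_tendsto_compose[OF cont conv] by (rule tendsto_norm)
  then have "eventually (\<lambda>k. norm (g z) / 2 < norm (g (x k))) sequentially"
    using \<open>g z \<noteq> 0\<close> by (intro order_tendstoD(1)) auto
  then have g_large: "eventually (\<lambda>k. \<gamma> \<le> \<nu> (g (x k))) sequentially"
  proof eventually_elim
    case (elim k)
    then have "a * (norm (g z) / 2) \<le> a * norm (g (x k))"
      using ab by (intro mult_left_mono) auto
    then show ?case
      using ab(3)[of "g (x k)"] by (simp add: \<gamma>_def)
  qed
  \<comment> \<open>The maximum with \<open>1\<close> is positive and can serve as a divisor in \<open>R\<^sub>0\<close>.\<close>
  define K' where "K' = max K 1"
  \<comment> \<open>For a radius below \<open>R\<^sub>0\<close> the step lies in the range of the model estimate, the minimum in the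
    reduction bound is the radius, and the model error is at most \<open>1 - \<mu>\<^sub>1\<close> times the predicted
    reduction. The factor \<open>\<rho>\<^sub>1\<close> in \<open>\<theta>\<close> accounts for the step before the final one, whose
    radius is larger by the factor \<open>1 / \<rho>\<^sub>1\<close>.\<close>
  define R\<^sub>0 where "R\<^sub>0 = min (\<gamma> / M) (min (a * r) (a\<^sup>2 * (1 - \<mu>\<^sub>1) * \<beta> * \<gamma> / K'))"
  define \<theta> where "\<theta> = \<rho>\<^sub>1 * R\<^sub>0"
  have K': "0 < K'" "K \<le> K'"
    by (auto simp: K'_def)
  have "0 < R\<^sub>0"
    using \<open>0 < \<gamma>\<close> params r ab K' by (simp add: R\<^sub>0_def)
  then have "0 < \<theta>" "\<theta> < R\<^sub>0"
    using params by (simp_all add: \<theta>_def)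
  have "(\<lambda>k. T k - f (x (Suc k))) \<longlonglongrightarrow> l - l"
    using T_conv LIMSEQ_Suc[OF f_conv] by (rule tendsto_diff)
  then have "eventually (\<lambda>k. T k - f (x (Suc k)) < \<mu>\<^sub>1 * (\<beta> * \<gamma> * \<theta>)) sequentially"
    using params \<open>0 < \<gamma>\<close> \<open>0 < \<theta>\<close> by (intro order_tendstoD(2)) auto
  moreover have "eventually (\<lambda>k. dist (x k) z < r) sequentially"
    using conv r by (rule tendstoD)
  ultimately obtain k where k: "T k - f (x (Suc k)) < \<mu>\<^sub>1 * (\<beta> * \<gamma> * \<theta>)" "dist (x k) z < r"
      "\<gamma> \<le> \<nu> (g (x k))" "f (x k) \<le> T k"
    using eventually_happens'[OF _ eventually_conj[OF _ eventually_conj[OF _ eventually_conj[OF g_large T_ge]]]]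
    by (metis (no_types, lifting) sequentially_bot)
  have steps: "\<nu> (d k i) \<le> \<rho>\<^sub>1 ^ i * \<delta> k" if "i \<le> p k" for i
    using run that by (auto simp: nmtr_run_def)
  have \<gamma>M: "\<gamma> / M \<le> \<nu> (g (x k)) / M"
    using k(3) params by (intro divide_right_mono) auto
  have "0 < \<delta> k"
    using radius[of k] \<gamma>M divide_pos_pos[OF \<open>0 < \<gamma>\<close> \<open>0 < M\<close>] by linarith
  have red_ge: "\<beta> * \<gamma> * min (\<rho>\<^sub>1 ^ i * \<delta> k) (\<gamma> / M) \<le> red k i" if "i \<le> p k" for i
  proof -
    have "\<beta> * \<gamma> * min (\<rho>\<^sub>1 ^ i * \<delta> k) (\<gamma> / M)
        \<le> \<beta> * \<nu> (g (x k)) * min (\<rho>\<^sub>1 ^ i * \<delta> k) (\<nu> (g (x k)) / M)"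
      using k(3) params \<open>0 < \<gamma>\<close> \<open>0 < \<delta> k\<close> \<gamma>M by (intro mult_mono) auto
    also have "\<dots> \<le> red k i"
      unfolding red_def by (rule reduction[OF that])
    finally show ?thesis .
  qed
  have red_pos: "0 < red k i" if "i \<le> p k" for i
  proof -
    have "0 < \<beta> * \<gamma> * min (\<rho>\<^sub>1 ^ i * \<delta> k) (\<gamma> / M)"
      using params \<open>0 < \<gamma>\<close> \<open>0 < \<delta> k\<close> by simp
    then show ?thesis
      using red_ge[OF that] by linarith
  qed
  \<comment> \<open>An accepted step has predicted reduction at most \<open>(T k - f (x (Suc k))) / \<mu>\<^sub>1\<close>, which was chosen
    small; while the gradient is large, this is possible only for a small radius.\<close>
  have small: "\<rho>\<^sub>1 ^ p k * \<delta> k < \<theta>"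
  proof -
    have "\<mu>\<^sub>1 \<le> rhat f g (B k) (T k) (x k) (d k (p k))" "x (Suc k) = x k + d k (p k)"
      using run by (auto simp: nmtr_run_def)
    then have "\<mu>\<^sub>1 * red k (p k) \<le> T k - f (x (Suc k))"
      using red_pos[of "p k"] by (simp add: rhat_def red_def pos_le_divide_eq)
    moreover have "\<mu>\<^sub>1 * (\<beta> * \<gamma> * min (\<rho>\<^sub>1 ^ p k * \<delta> k) (\<gamma> / M)) \<le> \<mu>\<^sub>1 * red k (p k)"
      using red_ge[of "p k"] params by (intro mult_left_mono) auto
    ultimately have "\<mu>\<^sub>1 * (\<beta> * \<gamma> * min (\<rho>\<^sub>1 ^ p k * \<delta> k) (\<gamma> / M)) < \<mu>\<^sub>1 * (\<beta> * \<gamma> * \<theta>)"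
      using k(1) by linarith
    then have "min (\<rho>\<^sub>1 ^ p k * \<delta> k) (\<gamma> / M) < \<theta>"
      using params \<open>0 < \<gamma>\<close> by simp
    then show ?thesis
      using \<open>\<theta> < R\<^sub>0\<close> unfolding R\<^sub>0_def by linarith
  qed
  show False
  proof (cases "p k")
    case 0
    then show ?thesis
      using small radius[of k] \<gamma>M \<open>\<theta> < R\<^sub>0\<close> by (simp add: R\<^sub>0_def)
  next
    case (Suc i)
    define R where "R = \<rho>\<^sub>1 ^ i * \<delta> k"
    have "0 < R"
      using params \<open>0 < \<delta> k\<close> by (simp add: R_def)
    have "R < R\<^sub>0"
      using small Suc params by (simp add: R_def \<theta>_def mult.assoc)
    then have R: "R < \<gamma> / M" "R < a * r" "R < a\<^sup>2 * (1 - \<mu>\<^sub>1) * \<beta> * \<gamma> / K'"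
      by (auto simp: R\<^sub>0_def)
    have "a * norm (d k i) \<le> R"
      using ab(3)[of "d k i"] steps[of i] Suc by (simp add: R_def)
    then have "norm (d k i) \<le> R / a"
      using ab by (simp add: pos_le_divide_eq mult.commute)
    also have "R / a < r"
      using R(2) ab by (simp add: pos_divide_less_eq mult.commute)
    finally have "norm (d k i) < r" .
    then have "\<bar>f (x k + d k i) - quad_model f g (B k) (x k) (d k i)\<bar> \<le> K * (norm (d k i))\<^sup>2"
      using model k(2) by blast
    also have "\<dots> \<le> K' * (R / a)\<^sup>2"
      using K' \<open>norm (d k i) \<le> R / a\<close> by (intro mult_mono power_mono) auto
    also have "\<dots> = (K' / a\<^sup>2 * R) * R"
      by (simp add: power2_eq_square)
    also have "\<dots> \<le> ((1 - \<mu>\<^sub>1) * \<beta> * \<gamma>) * R"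
      using R(3) K' ab \<open>0 < R\<close> by (intro mult_right_mono) (auto simp: field_simps)
    also have "\<dots> \<le> (1 - \<mu>\<^sub>1) * red k i"
      using red_ge[of i] R(1) Suc params
        mult_left_mono[of "\<beta> * \<gamma> * R" "red k i" "1 - \<mu>\<^sub>1"]
      by (simp add: R_def min_absorb1 mult_ac)
    finally have "\<mu>\<^sub>1 \<le> rhat f g (B k) (T k) (x k) (d k i)"
      using k(4) red_pos[of i] Suc by (intro rhat_ge) (auto simp: red_def)
    moreover have "rhat f g (B k) (T k) (x k) (d k i) < \<mu>\<^sub>1"
      using run Suc by (auto simp: nmtr_run_def)
    ultimately show ?thesis
      by simp
  qed
qed

section \<open>Superlinear convergence from superlinearly shrinking steps\<close>

text \<open>
  Once each step is at most half of its predecessor, the remaining distance to the limit is at most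
  twice the current step. So the next error is bounded by twice the next step, which is a small
  fraction of the current step, and the latter is at most the sum of both errors; the next error on
  the right can be absorbed.
\<close>

lemma superlinear_of_steps:
  fixes x :: "nat \<Rightarrow> 'a::real_normed_vector"
  assumes conv: "x \<longlonglongrightarrow> z"
    and steps: "(\<lambda>k. norm (x (Suc (Suc k)) - x (Suc k))) \<in> o(\<lambda>k. norm (x (Suc k) - x k))"
  shows "(\<lambda>k. norm (x (Suc k) - z)) \<in> o(\<lambda>k. norm (x k - z))"
proof (rule landau_o.smallI)
  fix C :: real
  assume "0 < C"
  define s where "s k = norm (x (Suc k) - x k)" for k
  \<comment> \<open>At most \<open>1 / 4\<close>, so that \<open>2 * \<theta>\<close> times the next error is at most half of it and can be
    absorbed.\<close>
  define \<theta> where "\<theta> = min C 1 / 4"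
  have \<theta>: "0 < \<theta>" "\<theta> \<le> 1 / 4" "4 * \<theta> \<le> C"
    using \<open>0 < C\<close> by (auto simp: \<theta>_def)
  have "eventually (\<lambda>k. s (Suc k) \<le> \<theta> * s k) sequentially"
    using landau_o.smallD[OF steps \<theta>(1)] by (simp add: s_def)
  then obtain K where K: "\<And>k. K \<le> k \<Longrightarrow> s (Suc k) \<le> \<theta> * s k"
    by (auto simp: eventually_sequentially)
  have tail: "norm (x k - z) \<le> 2 * s k" if "K \<le> k" for k
  proof -
    \<comment> \<open>The term \<open>- 2 * s (k + m)\<close> reserves room for the steps still to come; without it the
      bound is not inductive.\<close>
    have partial: "norm (x (k + m) - x k) \<le> 2 * s k - 2 * s (k + m)" for m
    proof (induction m)
      case (Suc m)
      have "s (Suc (k + m)) \<le> \<theta> * s (k + m)"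
        using K[of "k + m"] that by simp
      also have "\<dots> \<le> 1 / 2 * s (k + m)"
        using \<theta> by (intro mult_right_mono) (auto simp: s_def)
      finally have "2 * s (Suc (k + m)) \<le> s (k + m)"
        by simp
      then show ?case
        using Suc norm_triangle_ineq[of "x (k + m) - x k" "x (Suc (k + m)) - x (k + m)"]
        by (simp add: s_def)
    qed simp
    have "norm (x (k + m) - x k) \<le> 2 * s k" for m
      using partial[of m] norm_ge_zero[of "x (Suc (k + m)) - x (k + m)"]
      unfolding s_def by linarith
    moreover have "(\<lambda>m. norm (x (k + m) - x k)) \<longlonglongrightarrow> norm (z - x k)"
      using LIMSEQ_ignore_initial_segment[OF conv, of k]
      by (intro tendsto_intros) (simp add: add.commute)
    ultimately show ?thesis
      by (simp add: LIMSEQ_le_const2 norm_minus_commute)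
  qed
  have "norm (x (Suc k) - z) \<le> C * norm (x k - z)" if "K \<le> k" for k
  proof -
    define e where "e = norm (x (Suc k) - z)"
    define e' where "e' = norm (x k - z)"
    have "e \<le> 2 * s (Suc k)"
      using tail[of "Suc k"] that by (simp add: e_def)
    also have "\<dots> \<le> 2 * \<theta> * s k"
      using K[OF that] by simp
    also have "\<dots> \<le> 2 * \<theta> * (e + e')"
      using \<theta> norm_triangle_ineq4[of "x (Suc k) - z" "x k - z"]
      by (intro mult_left_mono) (auto simp: s_def e_def e'_def)
    also have "2 * \<theta> * (e + e') \<le> 1 / 2 * e + 2 * \<theta> * e'"
      using \<theta> mult_right_mono[of "2 * \<theta>" "1 / 2" e] by (simp add: algebra_simps e_def)
    finally have "e \<le> (4 * \<theta>) * e'"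
      by simp
    also have "\<dots> \<le> C * e'"
      using \<theta> by (intro mult_right_mono) (auto simp: e'_def)
    finally show ?thesis
      by (simp add: e_def e'_def)
  qed
  then show "eventually (\<lambda>k. norm (norm (x (Suc k) - z)) \<le> C * norm (norm (x k - z))) sequentially"
    unfolding eventually_sequentially by auto
qed

section \<open>Acceptance of the Newton step and superlinear convergence\<close>

theorem theorem13:
  fixes \<nu> :: "real ^ 'n \<Rightarrow> real"
    and f :: "real ^ 'n \<Rightarrow> real" and g :: "real ^ 'n \<Rightarrow> real ^ 'n"
    and H :: "real ^ 'n \<Rightarrow> real ^ 'n ^ 'n"
    and N :: nat and \<eta> T \<delta> :: "nat \<Rightarrow> real"
    and \<mu>\<^sub>1 \<mu>\<^sub>2 \<rho>\<^sub>1 \<rho>\<^sub>2 \<beta> M c \<epsilon> :: real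
    and B :: "nat \<Rightarrow> real ^ 'n ^ 'n" and x :: "nat \<Rightarrow> real ^ 'n"
    and p :: "nat \<Rightarrow> nat" and d :: "nat \<Rightarrow> nat \<Rightarrow> real ^ 'n"
    and xstar :: "real ^ 'n"
  assumes norm: "is_norm \<nu>"
    and grad: "\<And>y. GDERIV f y :> g y" and grad_cont: "continuous_on UNIV g"
    and bdd: "bdd_below (f ` {y. f y \<le> f (x 0)})"
    and params: "1 \<le> N" "\<And>i. 0 \<le> \<eta> i \<and> \<eta> i < 1"
      "0 < \<mu>\<^sub>1" "\<mu>\<^sub>1 \<le> \<mu>\<^sub>2" "\<mu>\<^sub>2 < 1" "0 < \<rho>\<^sub>1" "\<rho>\<^sub>1 < 1" "1 \<le> \<rho>\<^sub>2"
    and nm_term: "T = nm_term1 N \<eta> (\<lambda>k. f (x k)) \<or> T = nm_term2 N \<eta> (\<lambda>k. f (x k))"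
    and run: "nmtr_run \<nu> f g \<mu>\<^sub>1 \<mu>\<^sub>2 \<rho>\<^sub>1 \<rho>\<^sub>2 T B x \<delta> p d"
    and beta: "0 < \<beta>" "\<beta> < 1"
    and reduction: "\<And>k i. i \<le> p k \<Longrightarrow>
          sufficient_reduction \<nu> f g \<beta> (B k) (x k) (\<rho>\<^sub>1 ^ i * \<delta> k) (d k i)"
    and B_bound: "0 < M" "\<And>k. induced_norm \<nu> (B k) \<le> M"
    and step_bound: "0 < c" "\<And>k i. i \<le> p k \<Longrightarrow> \<nu> (d k i) \<le> c * \<nu> (g (x k))"
    and conv: "x \<longlonglongrightarrow> xstar"
    and newton_step: "\<And>k. invertible (B k)" "\<And>k. d k 0 = - (matrix_inv (B k) *v g (x k))"
      "\<And>k. \<nu> (d k 0) \<le> \<delta> k"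
    and hessian: "0 < \<epsilon>"
      "\<And>y. \<nu> (y - xstar) < \<epsilon> \<Longrightarrow> (g has_derivative (\<lambda>h. H y *v h)) (at y)"
      "continuous_on {y. \<nu> (y - xstar) < \<epsilon>} H"
    and dennis_more: "(\<lambda>k. \<nu> ((B k - H xstar) *v d k 0) / \<nu> (d k 0)) \<longlonglongrightarrow> 0"
  shows "(\<exists>k\<^sub>1. \<forall>k\<ge>k\<^sub>1. x (Suc k) = x k + d k 0 \<and> d k 0 = - (matrix_inv (B k) *v g (x k))) \<and>
         (\<lambda>k. \<nu> (x (Suc k) - xstar)) \<in> o(\<lambda>k. \<nu> (x k - xstar))"
proof -
  obtain a b where ab: "0 < a" "0 < b" "\<And>v. a * norm v \<le> \<nu> v" "\<And>v. \<nu> v \<le> b * norm v"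
    using norm_equivalence[OF norm] by blast
  define s where "s k = d k 0" for k
  define D where "D k = B k - H xstar" for k
  define U where "U = {y. \<nu> (y - xstar) < \<epsilon>}"
  have xstar_in_U: "xstar \<in> U"
    using hessian(1) by (simp add: U_def is_norm_zero[OF norm])
  have "continuous_on UNIV (\<lambda>y. \<nu> (y - xstar))"
    by (rule continuous_on_compose2[OF is_norm_continuous[OF norm, of UNIV]])
      (simp_all add: continuous_on_diff)
  then have open_U: "open U"
    unfolding U_def using continuous_on_const by (rule open_Collect_less)
  have deriv: "\<And>y. y \<in> U \<Longrightarrow> (g has_derivative (\<lambda>h. H y *v h)) (at y)"
    using hessian(2) by (simp add: U_def)
  have cont_H: "continuous_on U H"
    using hessian(3) by (simp add: U_def)
  have Bs: "B k *v s k = - g (x k)" for k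
    by (simp add: s_def newton_step(2) vec.neg matrix_inv_vector_cancel[OF newton_step(1)])
  have g_nz: "g (x k) \<noteq> 0" for k
    using run by (auto simp: nmtr_run_def)
  have B_nz: "B k \<noteq> 0" and s_nz: "s k \<noteq> 0" for k
    using Bs[of k] g_nz[of k] by auto
  have B_le: "\<nu> (B k *v h) \<le> M * \<nu> h" for k h
    using induced_norm_le[OF norm, of "B k" h] mult_right_mono[OF B_bound(2)[of k] is_norm_nonneg[OF norm, of h]]
    by linarith
  have s_ge: "\<nu> (g (x k)) / M \<le> \<nu> (s k)" for k
    using B_le[of k "s k"] B_bound(1) by (simp add: Bs is_norm_minus[OF norm] pos_divide_le_eq mult.commute)
  have radius: "\<nu> (g (x k)) / M \<le> \<delta> k" for k
    using s_ge[of k] newton_step(3)[of k] by (simp add: s_def)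
  have red: "\<beta> * \<nu> (g (x k)) * min (\<rho>\<^sub>1 ^ i * \<delta> k) (\<nu> (g (x k)) / M)
      \<le> quad_model f g (B k) (x k) 0 - quad_model f g (B k) (x k) (d k i)" if "i \<le> p k" for k i
    by (rule sufficient_reduction_bound[OF norm reduction[OF that] beta(1) B_nz B_bound(2)])

  have "isCont f xstar"
    using grad[of xstar] by (auto simp: gderiv_def intro: has_derivative_continuous)
  then have f_conv: "(\<lambda>k. f (x k)) \<longlonglongrightarrow> f xstar"
    using conv by (rule isCont_tendsto_compose)
  have g_cont: "isCont g xstar"
    using grad_cont by (simp add: continuous_on_eq_continuous_at)
  have T_ge: "eventually (\<lambda>k. f (x k) \<le> T k) sequentially" and T_conv: "T \<longlonglongrightarrow> f xstar"
    using nm_term_eventually[OF nm_term params(1,2) f_conv] by auto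

  have D_le: "norm (D k *v h) \<le> (M * b / a + onorm ((*v) (H xstar))) * norm h" for k h
  proof -
    have "a * norm (B k *v h) \<le> M * (b * norm h)"
      using ab(3)[of "B k *v h"] B_le[of k h] mult_left_mono[OF ab(4)[of h], of M] B_bound(1) by linarith
    then have "norm (B k *v h) \<le> M * b / a * norm h"
      using ab(1) by (simp add: field_simps)
    moreover have "norm (H xstar *v h) \<le> onorm ((*v) (H xstar)) * norm h"
      by (rule onorm[OF matrix_vector_mul_bounded_linear])
    ultimately show ?thesis
      using norm_triangle_ineq4[of "B k *v h" "H xstar *v h"]
      by (simp add: D_def matrix_vector_mult_diff_rdistrib algebra_simps)
  qed
  \<comment> \<open>The Dennis-More condition concerns the Newton steps alone. For arbitrary rejected steps the
    bound on the matrices makes the model error quadratic.\<close>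
  have "g xstar = 0"
  proof -
    obtain r where r: "0 < r" "\<And>B y h. dist y xstar < r \<Longrightarrow> norm h < r \<Longrightarrow>
       \<bar>f (y + h) - quad_model f g B y h\<bar>
         \<le> 1 * (norm h)\<^sup>2 + 1 / 2 * norm h * norm ((B - H xstar) *v h)"
      using model_error_uniform[OF grad open_U xstar_in_U deriv cont_H zero_less_one] by blast
    define K where "K = 1 + 1 / 2 * (M * b / a + onorm ((*v) (H xstar)))"
    have "\<bar>f (x k + h) - quad_model f g (B k) (x k) h\<bar> \<le> K * (norm h)\<^sup>2"
      if "dist (x k) xstar < r" "norm h < r" for k h
    proof -
      have "norm h * norm (D k *v h) \<le> norm h * ((M * b / a + onorm ((*v) (H xstar))) * norm h)"
        by (intro mult_left_mono D_le) simp
      then show ?thesis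
        using r(2)[OF that, of "B k"] by (simp add: K_def D_def power2_eq_square algebra_simps)
    qed
    from limit_is_stationary[OF norm run params(3) _ params(6,7) beta(1) B_bound(1) red radius conv g_cont
        f_conv T_conv T_ge r(1) this]
    show ?thesis
      using params(4,5) by simp
  qed
  with isCont_tendsto_compose[OF g_cont conv] have g_conv: "(\<lambda>k. g (x k)) \<longlonglongrightarrow> 0"
    by simp

  have s_le_g: "norm (s k) \<le> c * b / a * norm (g (x k))" for k
  proof -
    have "a * norm (s k) \<le> c * (b * norm (g (x k)))"
      using ab(3)[of "s k"] step_bound(2)[OF le0, of k]
        mult_left_mono[OF ab(4)[of "g (x k)"], of c] step_bound(1)
      unfolding s_def by linarith
    then show ?thesis
      using ab(1) by (simp add: field_simps)
  qed
  have s_conv: "s \<longlonglongrightarrow> 0"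
  proof (rule Lim_null_comparison)
    show "eventually (\<lambda>k. norm (s k) \<le> c * b / a * norm (g (x k))) sequentially"
      using s_le_g by simp
    show "(\<lambda>k. c * b / a * norm (g (x k))) \<longlonglongrightarrow> 0"
      using tendsto_mult_right_zero[OF tendsto_norm_zero[OF g_conv]] .
  qed
  have near: "eventually (\<lambda>k. dist (x k) xstar < r \<and> norm (s k) < r) sequentially" if "0 < r" for r
    using tendstoD[OF conv that] tendstoD[OF s_conv that] by eventually_elim simp

  have "(\<lambda>k. \<nu> (D k *v s k)) \<in> o(\<lambda>k. \<nu> (s k))"
    using dennis_more by (intro smalloI_tendsto) (auto simp: D_def s_def[symmetric] is_norm_eq_0[OF norm] s_nz)
  then have D_small: "(\<lambda>k. norm (D k *v s k)) \<in> o(\<lambda>k. norm (s k))"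
    by (simp add: is_norm_smallo_iff[OF norm])

  \<comment> \<open>Since \<open>B s = - g\<close>, both arguments of the minimum in the reduction bound are at least
    \<open>\<nu> g / M\<close>; together with \<open>\<nu> s \<le> c * \<nu> g\<close> this bounds the reduction below by \<open>(norm s)\<^sup>2\<close>.\<close>
  define \<kappa> where "\<kappa> = \<beta> * a\<^sup>2 / (M * c\<^sup>2)"
  have "0 < \<kappa>"
    using ab beta B_bound step_bound by (simp add: \<kappa>_def)
  have red_newton: "\<kappa> * (norm (s k))\<^sup>2
      \<le> quad_model f g (B k) (x k) 0 - quad_model f g (B k) (x k) (s k)" for k
  proof -
    have "a * norm (s k) \<le> c * \<nu> (g (x k))"
      using ab(3)[of "s k"] step_bound(2)[of 0 k] by (simp add: s_def)
    then have sq: "(a * norm (s k))\<^sup>2 \<le> (c * \<nu> (g (x k)))\<^sup>2"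
      using ab by (intro power_mono) auto
    have "\<kappa> * (norm (s k))\<^sup>2 = \<beta> / (M * c\<^sup>2) * (a * norm (s k))\<^sup>2"
      by (simp add: \<kappa>_def power_mult_distrib)
    also have "\<dots> \<le> \<beta> / (M * c\<^sup>2) * (c * \<nu> (g (x k)))\<^sup>2"
      using sq beta B_bound by (intro mult_left_mono) auto
    also have "\<dots> = \<beta> * \<nu> (g (x k)) * (\<nu> (g (x k)) / M)"
      using step_bound(1) by (simp add: power_mult_distrib power2_eq_square)
    finally have "\<kappa> * (norm (s k))\<^sup>2 \<le> \<beta> * \<nu> (g (x k)) * (\<nu> (g (x k)) / M)" .
    then show ?thesis
      using red[of 0 k] radius[of k] by (simp add: s_def min_absorb2)
  qed
  have newton_accepted: "eventually (\<lambda>k. p k = 0) sequentially"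
  proof -
    \<comment> \<open>The remainder and the Dennis-More term each get half of the error that acceptance allows.\<close>
    define e where "e = (1 - \<mu>\<^sub>1) * \<kappa> / 2"
    have "0 < e"
      using params \<open>0 < \<kappa>\<close> by (simp add: e_def)
    obtain r where r: "0 < r" "\<And>B y h. dist y xstar < r \<Longrightarrow> norm h < r \<Longrightarrow>
       \<bar>f (y + h) - quad_model f g B y h\<bar>
         \<le> e * (norm h)\<^sup>2 + 1 / 2 * norm h * norm ((B - H xstar) *v h)"
      using model_error_uniform[OF grad open_U xstar_in_U deriv cont_H \<open>0 < e\<close>] by blast
    show ?thesis
      using near[OF r(1)] landau_o.smallD[OF D_small \<open>0 < e\<close>] T_ge
    proof eventually_elim
      case (elim k)
      have "norm (s k) * norm (D k *v s k) \<le> norm (s k) * (e * norm (s k))"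
        using elim by (intro mult_left_mono) auto
      then have "\<bar>f (x k + s k) - quad_model f g (B k) (x k) (s k)\<bar> \<le> 2 * e * (norm (s k))\<^sup>2"
        using r(2)[of "x k" "s k" "B k"] elim \<open>0 < e\<close>
          mult_nonneg_nonneg[of e "(norm (s k))\<^sup>2"]
        by (simp add: D_def power2_eq_square algebra_simps)
      also have "2 * e * (norm (s k))\<^sup>2 = (1 - \<mu>\<^sub>1) * (\<kappa> * (norm (s k))\<^sup>2)"
        by (simp add: e_def)
      also have "\<dots> \<le> (1 - \<mu>\<^sub>1) * (quad_model f g (B k) (x k) 0 - quad_model f g (B k) (x k) (s k))"
        using red_newton params by (intro mult_left_mono) auto
      finally have err: "f (x k + s k) - quad_model f g (B k) (x k) (s k)
          \<le> (1 - \<mu>\<^sub>1) * (quad_model f g (B k) (x k) 0 - quad_model f g (B k) (x k) (s k))"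
        by linarith
      have "0 < \<kappa> * (norm (s k))\<^sup>2"
        using \<open>0 < \<kappa>\<close> s_nz by simp
      then have "0 < quad_model f g (B k) (x k) 0 - quad_model f g (B k) (x k) (s k)"
        using red_newton[of k] by linarith
      then have "\<mu>\<^sub>1 \<le> rhat f g (B k) (T k) (x k) (d k 0)"
        using elim err by (intro rhat_ge) (auto simp: s_def)
      moreover have "rhat f g (B k) (T k) (x k) (d k 0) < \<mu>\<^sub>1" if "0 < p k"
        using run that by (auto simp: nmtr_run_def)
      ultimately show "p k = 0"
        by force
    qed
  qed
  have x_Suc: "eventually (\<lambda>k. x (Suc k) = x k + s k) sequentially"
    using newton_accepted by eventually_elim (use run in \<open>auto simp: nmtr_run_def s_def\<close>)

  have s_small: "(\<lambda>k. norm (s (Suc k))) \<in> o(\<lambda>k. norm (s k))"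
  proof (rule landau_o.smallI)
    fix C :: real
    assume "0 < C"
    \<comment> \<open>Twice \<open>e\<close>, for the linearization and the Dennis-More term, times the factor \<open>c * b / a\<close>
      between gradient and step, is \<open>C\<close>.\<close>
    define e where "e = C * a / (2 * c * b)"
    have "0 < e"
      using \<open>0 < C\<close> ab step_bound by (simp add: e_def)
    obtain r where r: "0 < r" "\<And>y h. dist y xstar < r \<Longrightarrow> norm h < r \<Longrightarrow>
        norm (g (y + h) - g y - H xstar *v h) \<le> e * norm h"
      using gradient_linearization[OF open_U xstar_in_U deriv cont_H \<open>0 < e\<close>] by blast
    show "eventually (\<lambda>k. norm (norm (s (Suc k))) \<le> C * norm (norm (s k))) sequentially"
      using near[OF r(1)] landau_o.smallD[OF D_small \<open>0 < e\<close>] x_Suc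
    proof eventually_elim
      case (elim k)
      \<comment> \<open>The Newton equation \<open>B s = - g\<close> cancels the zeroth order term of the linearization.\<close>
      have g_eq: "g (x (Suc k)) = (g (x k + s k) - g (x k) - H xstar *v s k) - D k *v s k"
        using elim Bs[of k] by (simp add: D_def matrix_vector_mult_diff_rdistrib)
      have "norm (g (x k + s k) - g (x k) - H xstar *v s k) \<le> e * norm (s k)"
        using elim r(2) by blast
      moreover have "norm (D k *v s k) \<le> e * norm (s k)"
        using elim by simp
      ultimately have "norm (g (x (Suc k))) \<le> 2 * e * norm (s k)"
        unfolding g_eq
        using norm_triangle_ineq4[of "g (x k + s k) - g (x k) - H xstar *v s k" "D k *v s k"]
        by linarith
      then have "c * b / a * norm (g (x (Suc k))) \<le> c * b / a * (2 * e * norm (s k))"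
        using ab step_bound(1) by (intro mult_left_mono) auto
      also have "\<dots> = C * norm (s k)"
        using ab step_bound(1) by (simp add: e_def)
      finally show ?case
        using s_le_g[of "Suc k"] by simp
    qed
  qed
  have step_eq: "eventually (\<lambda>k. norm (x (Suc k) - x k) = norm (s k)) sequentially"
    using x_Suc by eventually_elim simp
  then have step_eq_Suc:
    "eventually (\<lambda>k. norm (x (Suc (Suc k)) - x (Suc k)) = norm (s (Suc k))) sequentially"
    by (rule eventually_compose_filterlim[OF _ filterlim_Suc])
  have "(\<lambda>k. norm (x (Suc (Suc k)) - x (Suc k))) \<in> o(\<lambda>k. norm (x (Suc k) - x k))"
    unfolding landau_o.small.cong[OF step_eq] landau_o.small.in_cong[OF step_eq_Suc]
    by (rule s_small)
  from superlinear_of_steps[OF conv this]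
  have "(\<lambda>k. \<nu> (x (Suc k) - xstar)) \<in> o(\<lambda>k. \<nu> (x k - xstar))"
    unfolding is_norm_smallo_iff[OF norm] .
  moreover have "\<exists>k\<^sub>1. \<forall>k\<ge>k\<^sub>1. x (Suc k) = x k + d k 0 \<and> d k 0 = - (matrix_inv (B k) *v g (x k))"
    using x_Suc newton_step(2) by (auto simp: eventually_sequentially s_def)
  ultimately show ?thesis
    by (rule conjI[rotated])
qed

end
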